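(* Assume that the certification procedure with lift-partition-project step, with $\mathcal{E}=\mathcal{E}_k$ at iteration $k$, is started with $q_0\in Q$ and $\Theta_0$. Moreover, let $(\Theta,\{q_k\}_k)$ be any tuple in the final partition $\mathcal{F}$. Then, for any $\tilde\theta\in\Theta$ there exists a sequence of errors $\{\epsilon_k\}_k$, $\epsilon_k\in\mathcal{E}_k$, that makes the solver automaton generate a solver-state sequence $\{\tilde q_k\}_k$ which satisfies $\tilde q_k=q_k$ for all $k$, if the intermediate variable at iteration $k$ of the solver automaton is $z_k=z_k(\tilde\theta)+\epsilon_k$ and the starting state is $q_0$.
   Context: Data. $Q$ is a set of solver states, some of which mark termination; $\Theta_0\subseteq\mathbb{R}^{n_\theta}$ is a polyhedron of parameters. Each $q\in Q$ determines: a dimension $n_z(q)$; a family of polyhedra $\mathcal{Z}^i=\{z: A^iz\le b^i\}$, $i=1,\dots,N$ (with $A^i,b^i,N$ depending on $q$), that partitions $\mathbb{R}^{n_z(q)}$, meaning that distinct members have disjoint interiors and $\bigcup_i\mathcal{Z}^i=\mathbb{R}^{n_z(q)}$; and an affine map $z(\theta)=F_q\theta+g_q\in\mathbb{R}^{n_z(q)}$ (the intermediate variable). There is a transition function $\delta:Q\times\mathbb{Z}\to Q$. When the current state at iteration $k$ is $q_k$, $z_k(\theta)$ denotes $F_{q_k}\theta+g_{q_k}$. Solver automaton. Given the starting state $q_0$, start with $k=0$ and the empty sequence $\mathbb{Q}$, and repeat: append $q_k$ to $\mathbb{Q}$; generate the polyhedra $\{z:A^iz\le b^i\}_i$ and the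 vector $z_k$ based on $q_k$; find $i$ such that $A^iz_k\le b^i$; set $q_{k+1}=\delta(q_k,i)$; increase $k$ by one; until $q_k$ marks termination. Then return $\mathbb{Q}$, the solver-state sequence. Errors. $\mathcal{E}_k$ is the set modelling the possible numerical errors $\epsilon_k$ in the intermediate variable at iteration $k$; its elements have the dimension of the intermediate variable. Certification procedure with lift-partition-project step. Input $\Theta_0,q_0$. Initialize a stack $S$ containing only $(\Theta_0,q_0,\emptyset)$, where $\emptyset$ is the empty sequence, and $\mathcal{F}=\emptyset$. While $S\ne\emptyset$: pop a tuple $(\Theta,q,\mathbb{Q})$ from $S$; append $q$ to $\mathbb{Q}$; generate the polyhedra $\{z:A^iz\le b^i\}_{i=1}^N$ and the map $z(\theta)$ based on $q$; with $\mathcal{E}=\mathcal{E}_k$, where $k$ is the iteration number of the tuple (the number of state updates made from $q_0$ to reach it), lift $\Theta$ to $\Psi=\Theta\times\mathcal{E}$, form for each $i$ the set $\Psi^i=\{(\theta,\epsilon)\in\Theta\times\mathcal{E}: A^i(z(\theta)+\epsilon)\le b^i\}$, and project it to $\tilde\Theta^i=\{\theta\in\Theta:\exists\,\epsilon\in\mathcal{E},\ (\theta,\epsilon)\in\Psi^i\}$; for each $i$ with $\tilde\Theta^i\ne\emptyset$, set $q^i=\delta(q,i)$, and if $q^i$ marks termination push $(\tilde\Theta^i,\mathbb{Q})$ to $\mathcal{F}$, otherwise push $(\tilde\Theta^i,q^i,\mathbb{Q})$ to $S$. When $S$ is empty, return $\mathcal{F}$, called the final partition. *)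

theory Defs
  imports
    "HOL-Analysis.Function_Topology"
    "HOL-Library.While_Combinator"
    "Jordan_Normal_Form.Matrix"
begin

(* The dimension of the intermediate variable depends on the solver state, so points of R^n are
   represented by vectors over carrier_vec n. The order on vectors is componentwise and entails
   equality of dimensions. *)

definition Rn_topology :: "nat \<Rightarrow> real vec topology" where
  "Rn_topology n =
     pullback_topology (carrier_vec n) (\<lambda>x. \<lambda>j\<in>{..<n}. x $ j) (powertop_real {..<n})"

definition polyhedron_of :: "nat \<Rightarrow> real mat \<Rightarrow> real vec \<Rightarrow> real vec set" where
  "polyhedron_of n A b = {x \<in> carrier_vec n. A *\<^sub>v x \<le> b}"

definition is_polyhedron :: "nat \<Rightarrow> real vec set \<Rightarrow> bool" where
  "is_polyhedron n P \<longleftrightarrow>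
     (\<exists>m A b. A \<in> carrier_mat m n \<and> b \<in> carrier_vec m \<and> P = polyhedron_of n A b)"

record 'q solver =
  states :: "'q set"
  terminal :: "'q \<Rightarrow> bool"
  zdim :: "'q \<Rightarrow> nat"
  npoly :: "'q \<Rightarrow> nat"
  Amat :: "'q \<Rightarrow> nat \<Rightarrow> real mat"
  bvec :: "'q \<Rightarrow> nat \<Rightarrow> real vec"
  Fmat :: "'q \<Rightarrow> real mat"
  gvec :: "'q \<Rightarrow> real vec"
  trans_fun :: "'q \<Rightarrow> int \<Rightarrow> 'q"

definition region :: "'q solver \<Rightarrow> 'q \<Rightarrow> nat \<Rightarrow> real vec set" where
  "region S q i = polyhedron_of (zdim S q) (Amat S q i) (bvec S q i)"

definition zmap :: "'q solver \<Rightarrow> 'q \<Rightarrow> real vec \<Rightarrow> real vec" where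
  "zmap S q \<theta> = Fmat S q *\<^sub>v \<theta> + gvec S q"

definition wf_solver :: "nat \<Rightarrow> 'q solver \<Rightarrow> bool" where
  "wf_solver n\<theta> S \<longleftrightarrow>
     (\<forall>q\<in>states S.
        Fmat S q \<in> carrier_mat (zdim S q) n\<theta> \<and> gvec S q \<in> carrier_vec (zdim S q) \<and>
        (\<forall>i\<in>{1..npoly S q}. \<exists>m. Amat S q i \<in> carrier_mat m (zdim S q) \<and> bvec S q i \<in> carrier_vec m) \<and>
        (\<forall>i\<in>{1..npoly S q}. \<forall>j\<in>{1..npoly S q}. region S q i \<noteq> region S q j \<longrightarrow>
           Rn_topology (zdim S q) interior_of region S q i \<inter>
           Rn_topology (zdim S q) interior_of region S q j = {}) \<and>
        (\<Union>i\<in>{1..npoly S q}. region S q i) = carrier_vec (zdim S q) \<and>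
        (\<forall>i. trans_fun S q i \<in> states S))"

(* Here z k q is the intermediate variable used at iteration k if the current state is q.
   solver_loop S z k q qs out: the repeat-loop, about to start iteration k in state q with the
   states qs recorded so far, can end and return out. The choice of i is not deterministic,
   since the polyhedra overlap on their boundaries. *)
inductive solver_loop ::
  "'q solver \<Rightarrow> (nat \<Rightarrow> 'q \<Rightarrow> real vec) \<Rightarrow> nat \<Rightarrow> 'q \<Rightarrow> 'q list \<Rightarrow> 'q list \<Rightarrow> bool"
  for S z
where
  stop: "\<lbrakk>i \<in> {1..npoly S q}; Amat S q i *\<^sub>v z k q \<le> bvec S q i;
          terminal S (trans_fun S q (int i))\<rbrakk>
         \<Longrightarrow> solver_loop S z k q qs (qs @ [q])"
| continue: "\<lbrakk>i \<in> {1..npoly S q}; Amat S q i *\<^sub>v z k q \<le> bvec S q i;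
          \<not> terminal S (trans_fun S q (int i));
          solver_loop S z (Suc k) (trans_fun S q (int i)) (qs @ [q]) out\<rbrakk>
         \<Longrightarrow> solver_loop S z k q qs out"

definition solver_generates ::
  "'q solver \<Rightarrow> (nat \<Rightarrow> 'q \<Rightarrow> real vec) \<Rightarrow> 'q \<Rightarrow> 'q list \<Rightarrow> bool" where
  "solver_generates S z q0 qs \<longleftrightarrow> solver_loop S z 0 q0 [] qs"

(* E k is the set of errors at iteration k. Its elements have the dimension of the intermediate
   variable; as this dimension may differ between states that are reached at the same iteration,
   E k may contain vectors of several dimensions and those matching the state are used. If the
   dimension is constant and E k consists of vectors of that dimension, errors S E k q = E k. *)
definition errors :: "'q solver \<Rightarrow> (nat \<Rightarrow> real vec set) \<Rightarrow> nat \<Rightarrow> 'q \<Rightarrow> real vec set" where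
  "errors S E k q = E k \<inter> carrier_vec (zdim S q)"

definition lifted_part ::
  "'q solver \<Rightarrow> real vec set \<Rightarrow> real vec set \<Rightarrow> 'q \<Rightarrow> nat \<Rightarrow> (real vec \<times> real vec) set" where
  "lifted_part S \<E> \<Theta> q i =
     {(\<theta>, \<epsilon>) \<in> \<Theta> \<times> \<E>. Amat S q i *\<^sub>v (zmap S q \<theta> + \<epsilon>) \<le> bvec S q i}"

definition projected_part ::
  "'q solver \<Rightarrow> real vec set \<Rightarrow> real vec set \<Rightarrow> 'q \<Rightarrow> nat \<Rightarrow> real vec set" where
  "projected_part S \<E> \<Theta> q i = {\<theta> \<in> \<Theta>. \<exists>\<epsilon>\<in>\<E>. (\<theta>, \<epsilon>) \<in> lifted_part S \<E> \<Theta> q i}"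

type_synonym 'q cert_config =
  "(real vec set \<times> 'q \<times> 'q list) list \<times> (real vec set \<times> 'q list) set"

definition cert_push ::
  "'q solver \<Rightarrow> real vec set \<Rightarrow> real vec set \<Rightarrow> 'q \<Rightarrow> 'q list \<Rightarrow> nat \<Rightarrow> 'q cert_config \<Rightarrow> 'q cert_config"
where
  "cert_push S \<E> \<Theta> q qs i = (\<lambda>(stack, \<F>).
     let \<Theta>i = projected_part S \<E> \<Theta> q i; qi = trans_fun S q (int i) in
     if \<Theta>i = {} then (stack, \<F>)
     else if terminal S qi then (stack, insert (\<Theta>i, qs) \<F>)
     else ((\<Theta>i, qi, qs) # stack, \<F>))"

(* Every state update appends one state to the recorded sequence, so the iteration number of a
   popped tuple is the length of its sequence. *)
fun cert_step :: "'q solver \<Rightarrow> (nat \<Rightarrow> real vec set) \<Rightarrow> 'q cert_config \<Rightarrow> 'q cert_config" where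
  "cert_step S E ([], \<F>) = ([], \<F>)"
| "cert_step S E ((\<Theta>, q, qs) # stack, \<F>) =
     fold (cert_push S (errors S E (length qs) q) \<Theta> q (qs @ [q])) [1..<Suc (npoly S q)] (stack, \<F>)"

(* The returned final partition, or None if the procedure does not terminate. *)
definition final_partition ::
  "'q solver \<Rightarrow> (nat \<Rightarrow> real vec set) \<Rightarrow> real vec set \<Rightarrow> 'q \<Rightarrow> (real vec set \<times> 'q list) set option"
where
  "final_partition S E \<Theta>0 q0 =
     map_option snd
       (while_option (\<lambda>(stack, \<F>). stack \<noteq> []) (cert_step S E) ([(\<Theta>0, q0, [])], {}))"

end

(* A parameter lies in a tuple of the procedure only because, at every earlier iteration, projecting
   left behind some error steering the automaton along the recorded states. These errors are glued
   into one sequence by induction along the while loop; extending the sequence at iteration k does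
   not disturb the earlier iterations, since those only use the errors below k. *)
theory Submission
  imports Defs
begin

text \<open>What has to hold for a tuple of the final partition: the generated sequence is
  \<open>qs\<close> itself. Values of \<open>\<epsilon>\<close> from index \<open>length qs\<close>
  on are left free.\<close>

definition steers ::
  "'q solver \<Rightarrow> (nat \<Rightarrow> real vec set) \<Rightarrow> 'q \<Rightarrow> real vec \<Rightarrow> 'q list \<Rightarrow> (nat \<Rightarrow> real vec) \<Rightarrow> bool"
where
  "steers S E q0 \<theta> qs \<epsilon> \<longleftrightarrow>
     (\<forall>k<length qs. \<epsilon> k \<in> errors S E k (qs ! k)) \<and>
     solver_generates S (\<lambda>k q. zmap S q \<theta> + \<epsilon> k) q0 qs"

(* Reaching q is phrased backwards: every completed run from q is a completed run from q0, whatever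
   the errors from iteration length qs on. *)
definition steers_to ::
  "'q solver \<Rightarrow> (nat \<Rightarrow> real vec set) \<Rightarrow> 'q \<Rightarrow> real vec \<Rightarrow> 'q \<Rightarrow> 'q list \<Rightarrow> (nat \<Rightarrow> real vec) \<Rightarrow> bool"
where
  "steers_to S E q0 \<theta> q qs \<epsilon> \<longleftrightarrow>
     (\<forall>k<length qs. \<epsilon> k \<in> errors S E k (qs ! k)) \<and>
     (\<forall>\<epsilon>' out. (\<forall>k<length qs. \<epsilon>' k = \<epsilon> k) \<longrightarrow>
        solver_loop S (\<lambda>k q. zmap S q \<theta> + \<epsilon>' k) (length qs) q qs out \<longrightarrow>
        solver_generates S (\<lambda>k q. zmap S q \<theta> + \<epsilon>' k) q0 out)"

text \<open>The errors are chosen for each tuple and each parameter separately, because a projection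
  only promises some error per parameter. On the stack, \<open>q\<close> is not yet part of
  \<open>qs\<close>.\<close>

fun cert_invariant ::
  "'q solver \<Rightarrow> (nat \<Rightarrow> real vec set) \<Rightarrow> 'q \<Rightarrow> 'q cert_config \<Rightarrow> bool"
where
  "cert_invariant S E q0 (stack, \<F>) \<longleftrightarrow>
     (\<forall>(\<Theta>, q, qs) \<in> set stack. \<forall>\<theta>\<in>\<Theta>. \<exists>\<epsilon>. steers_to S E q0 \<theta> q qs \<epsilon>) \<and>
     (\<forall>(\<Theta>, qs) \<in> \<F>. \<forall>\<theta>\<in>\<Theta>. \<exists>\<epsilon>. steers S E q0 \<theta> qs \<epsilon>)"

lemma errors_snoc:
  assumes "\<forall>k<length qs. \<epsilon> k \<in> errors S E k (qs ! k)" and "e \<in> errors S E (length qs) q"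
  shows "\<forall>k<length (qs @ [q]). (\<epsilon>(length qs := e)) k \<in> errors S E k ((qs @ [q]) ! k)"
  using assms by (auto simp: nth_append less_Suc_eq)

lemma steers_toD:
  assumes "steers_to S E q0 \<theta> q qs \<epsilon>"
  shows "\<forall>k<length qs. \<epsilon> k \<in> errors S E k (qs ! k)"
    and "\<lbrakk>\<forall>k<length qs. \<epsilon>' k = \<epsilon> k;
          solver_loop S (\<lambda>k q. zmap S q \<theta> + \<epsilon>' k) (length qs) q qs out\<rbrakk>
         \<Longrightarrow> solver_generates S (\<lambda>k q. zmap S q \<theta> + \<epsilon>' k) q0 out"
  using assms unfolding steers_to_def by simp_all

text \<open>The loop may pick any polyhedron containing its point, hence also the index
  \<open>i\<close> followed by the procedure. With error \<open>e\<close> at iteration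
  \<open>length qs\<close> this ends the run at \<open>q\<close>; the earlier errors are untouched,
  so it counts as a run from \<open>q0\<close>.\<close>

lemma steers_stop:
  assumes "steers_to S E q0 \<theta> q qs \<epsilon>" and "e \<in> errors S E (length qs) q"
    and "i \<in> {1..npoly S q}" and "Amat S q i *\<^sub>v (zmap S q \<theta> + e) \<le> bvec S q i"
    and "terminal S (trans_fun S q (int i))"
  shows "steers S E q0 \<theta> (qs @ [q]) (\<epsilon>(length qs := e))"
proof -
  have "solver_loop S (\<lambda>k q. zmap S q \<theta> + (\<epsilon>(length qs := e)) k) (length qs) q qs (qs @ [q])"
    using assms(3-5) by (intro solver_loop.stop[of i]) auto
  moreover have "\<forall>k<length qs. (\<epsilon>(length qs := e)) k = \<epsilon> k"
    by simp
  ultimately have "solver_generates S (\<lambda>k q. zmap S q \<theta> + (\<epsilon>(length qs := e)) k) q0 (qs @ [q])"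
    using steers_toD(2)[OF assms(1)] by blast
  then show ?thesis
    unfolding steers_def using errors_snoc[OF steers_toD(1)[OF assms(1)] assms(2)] by (intro conjI)
qed

text \<open>One iteration at \<open>q\<close> is put in front of an arbitrary completed run from the
  successor; what is known about \<open>q\<close> then carries the longer run back to
  \<open>q0\<close>.\<close>

lemma steers_to_continue:
  assumes "steers_to S E q0 \<theta> q qs \<epsilon>" and "e \<in> errors S E (length qs) q"
    and "i \<in> {1..npoly S q}" and "Amat S q i *\<^sub>v (zmap S q \<theta> + e) \<le> bvec S q i"
    and "\<not> terminal S (trans_fun S q (int i))"
  shows "steers_to S E q0 \<theta> (trans_fun S q (int i)) (qs @ [q]) (\<epsilon>(length qs := e))"
proof -
  have "solver_generates S (\<lambda>k q. zmap S q \<theta> + \<epsilon>' k) q0 out"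
    if agree: "\<forall>k<length (qs @ [q]). \<epsilon>' k = (\<epsilon>(length qs := e)) k"
      and loop: "solver_loop S (\<lambda>k q. zmap S q \<theta> + \<epsilon>' k) (length (qs @ [q]))
                   (trans_fun S q (int i)) (qs @ [q]) out"
    for \<epsilon>' out
  proof -
    have here: "\<epsilon>' (length qs) = e" and before: "\<forall>k<length qs. \<epsilon>' k = \<epsilon> k"
      using agree by auto
    \<comment> \<open>Agreement up to and including index \<open>length qs\<close> forces error
      \<open>e\<close> here. The remaining run starts at iteration \<open>length (qs @ [q])\<close>,
      which is the \<open>Suc\<close> demanded by the rule.\<close>
    have "solver_loop S (\<lambda>k q. zmap S q \<theta> + \<epsilon>' k) (length qs) q qs out"
      by (rule solver_loop.continue[OF assms(3) _ assms(5)]) (use loop in \<open>simp_all add: here assms(4)\<close>)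
    then show ?thesis
      by (rule steers_toD(2)[OF assms(1) before])
  qed
  then show ?thesis
    unfolding steers_to_def by (intro conjI errors_snoc[OF steers_toD(1)[OF assms(1)] assms(2)]) blast
qed

lemma cert_push_invariant:
  assumes reach: "\<forall>\<theta>\<in>\<Theta>. \<exists>\<epsilon>. steers_to S E q0 \<theta> q qs \<epsilon>"
    and i: "i \<in> {1..npoly S q}" and inv: "cert_invariant S E q0 c"
  shows "cert_invariant S E q0 (cert_push S (errors S E (length qs) q) \<Theta> q (qs @ [q]) i c)"
proof -
  obtain stack \<F> where c: "c = (stack, \<F>)" by fastforce
  let ?P = "projected_part S (errors S E (length qs) q) \<Theta> q i"
  \<comment> \<open>The projected part lies inside \<open>\<Theta>\<close>, so \<open>reach\<close>
    supplies the earlier errors, while the projection supplies the error of the current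
    iteration.\<close>
  have part: "\<exists>\<epsilon> e. steers_to S E q0 \<theta> q qs \<epsilon> \<and> e \<in> errors S E (length qs) q \<and>
      Amat S q i *\<^sub>v (zmap S q \<theta> + e) \<le> bvec S q i" if "\<theta> \<in> ?P" for \<theta>
    using that reach unfolding projected_part_def lifted_part_def by blast
  have "\<exists>\<epsilon>. steers S E q0 \<theta> (qs @ [q]) \<epsilon>"
    if "terminal S (trans_fun S q (int i))" "\<theta> \<in> ?P" for \<theta>
    using part[OF that(2)] steers_stop[OF _ _ i _ that(1)] by blast
  moreover have "\<exists>\<epsilon>. steers_to S E q0 \<theta> (trans_fun S q (int i)) (qs @ [q]) \<epsilon>"
    if "\<not> terminal S (trans_fun S q (int i))" "\<theta> \<in> ?P" for \<theta>
    using part[OF that(2)] steers_to_continue[OF _ _ i _ that(1)] by blast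
  ultimately show ?thesis
    using inv unfolding c cert_push_def by (simp add: Let_def)
qed

lemma cert_step_invariant:
  assumes "cert_invariant S E q0 c"
  shows "cert_invariant S E q0 (cert_step S E c)"
  using assms
proof (cases "(S, E, c)" rule: cert_step.cases)
  case (2 S' E' \<Theta> q qs stack \<F>)
  then have c: "c = ((\<Theta>, q, qs) # stack, \<F>)" by simp
  have "cert_invariant S E q0 (fold (cert_push S (errors S E (length qs) q) \<Theta> q (qs @ [q]))
      [1..<Suc (npoly S q)] (stack, \<F>))"
  \<comment> \<open>The hypothesis on the popped tuple does not mention the accumulated
    configuration, so it stays available for every index of the fold.\<close>
  proof (rule fold_invariant[where Q = "\<lambda>i. i \<in> {1..npoly S q}"])
    show "cert_invariant S E q0 (stack, \<F>)"
      using assms unfolding c by simp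
    show "cert_invariant S E q0 (cert_push S (errors S E (length qs) q) \<Theta> q (qs @ [q]) i s)"
      if "i \<in> {1..npoly S q}" "cert_invariant S E q0 s" for i s
      using cert_push_invariant[OF _ that] assms unfolding c by simp
  qed auto
  then show ?thesis
    unfolding c by simp
qed simp

lemma final_partition_steers:
  assumes "final_partition S E \<Theta>0 q0 = Some \<F>" and "(\<Theta>, qs) \<in> \<F>" and "\<theta> \<in> \<Theta>"
  shows "\<exists>\<epsilon>. steers S E q0 \<theta> qs \<epsilon>"
proof -
  obtain stack where loop: "while_option (\<lambda>(stack, \<F>). stack \<noteq> []) (cert_step S E)
      ([(\<Theta>0, q0, [])], {}) = Some (stack, \<F>)"
    using assms(1) unfolding final_partition_def by auto
  \<comment> \<open>With no recorded states all conditions on errors are vacuous, and a run from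
    \<open>q0\<close> at iteration 0 is a generated one by definition.\<close>
  have "steers_to S E q0 \<theta>' q0 [] \<epsilon>" for \<theta>' \<epsilon>
    by (simp add: steers_to_def solver_generates_def)
  then have init: "cert_invariant S E q0 ([(\<Theta>0, q0, [])], {})"
    by auto
  \<comment> \<open>The result \<open>Some\<close> means that the loop has terminated, so the
    invariant passes to its last configuration, whose second component is
    \<open>\<F>\<close>.\<close>
  have "cert_invariant S E q0 (stack, \<F>)"
    by (rule while_option_rule[OF cert_step_invariant loop init])
  then show ?thesis
    using assms(2,3) by auto
qed

theorem theorem3:
  fixes S :: "'q solver" and n\<theta> :: nat and E :: "nat \<Rightarrow> real vec set"
    and \<Theta>0 \<Theta> :: "real vec set" and q0 :: 'q and qs :: "'q list"
    and \<F> :: "(real vec set \<times> 'q list) set" and \<theta> :: "real vec"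
  assumes "wf_solver n\<theta> S"
    and "is_polyhedron n\<theta> \<Theta>0"
    and "q0 \<in> states S"
    and "final_partition S E \<Theta>0 q0 = Some \<F>"
    and "(\<Theta>, qs) \<in> \<F>"
    and "\<theta> \<in> \<Theta>"
  shows "\<exists>\<epsilon> :: nat \<Rightarrow> real vec.
           (\<forall>k<length qs. \<epsilon> k \<in> errors S E k (qs ! k)) \<and>
           (\<exists>qs'. solver_generates S (\<lambda>k q. zmap S q \<theta> + \<epsilon> k) q0 qs' \<and>
                  length qs' = length qs \<and> (\<forall>k<length qs. qs' ! k = qs ! k))"
proof -
  obtain \<epsilon> where "steers S E q0 \<theta> qs \<epsilon>"
    using final_partition_steers[OF assms(4-6)] by blast
  then show ?thesis
    unfolding steers_def by (intro exI[of _ \<epsilon>] conjI exI[of _ qs]) simp_all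
qed

end
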